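(* Consider destination-based routing to a node $d$ in a connected graph $G=(V,E)$ and the version-numbered depth-label update scheme described in the context, in which a node $v$ may update to a larger version number $x$ if its parent $w$ in version $x$ is itself currently in version $x$ and $\mathrm{depth}_x(v)=\mathrm{depth}_x(w)+1$. This scheme is locally verifiable and preserves blackhole freedom and loop freedom. That is: (1) In every asynchronous execution of the scheme, with any number of subsequent versions (possibly overlapping in time, and with nodes possibly skipping versions), starting from an initial forwarding tree, every configuration reached is blackhole-free and loop-free, and every node outputs YES under the verifier of the context. (2) In every configuration that is not blackhole-free or not loop-free, at least one node outputs NO.
   Context: The network is a finite connected graph $G=(V,E)$ with a fixed destination $d\in V$. Packets carry no tags, and each node has at most one active forwarding rule for $d$. Configuration. A configuration assigns to each node $v$ an active label consisting of a version number $\mathrm{ver}(v)\in\mathbb{Z}_{\ge0}$, a parent $\mathrm{par}(v)$ that is either a neighbor of $v$ in $G$ or $\bot$ (no rule), and a depth in $\mathbb{Z}_{\ge0}$. A node $v$ with $\mathrm{par}(v)=w\neq\bot$ forwards all packets for $d$ to $w$. The configuration is blackhole-free if every $v\ne d$ has $\mathrm{par}(v)\neq\bot$. It is loop-free if the directed graph with edges $(v,\mathrm{par}(v))$, for $v$ with $\mathrm{par}(v)\neq\bot$, contains no directed cycle; this is a structural property of the current forwarding graph. Labels. For each version $x$, the label of version $x$ for node $v$ consists of $x$, a parent $\mathrm{par}_x(v)$ and a depth $\mathrm{depth}_x(v)$. The controller may issue versions $x=1,2,3,\dots$ over time, without waiting for earlier versions to be completed, sending each node at most one label per version. For $v\ne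 d$ the parent $\mathrm{par}_x(v)$ is a neighbor of $v$ (intended: the parent of $v$ in a spanning tree $T_x$ of $G$ rooted at $d$, with $\mathrm{depth}_x(v)$ its depth in $T_x$). For $d$ the label is $\mathrm{par}_x(d)=\bot$, $\mathrm{depth}_x(d)=0$. Update scheme. Initially every node has as its active label its version-$0$ label, given by parents and depths in a spanning tree $T_0$ of $G$ rooted at $d$. Labels arrive after arbitrary delays. The node $d$ may at any time make a received label of a version larger than its current one active. A node $v\ne d$ may make a received label of version $x>\mathrm{ver}(v)$ active if, with $w=\mathrm{par}_x(v)$, one has $\mathrm{ver}(w)=x$ and $\mathrm{depth}_x(v)=\mathrm{depth}_x(w)+1$. Nodes never switch to a smaller version number, and they may skip versions. Switches happen one at a time in any order allowed by these rules. Verifier. Each node sees its own active label and those of its neighbors. The node $d$ outputs YES iff its parent is $\bot$ and its depth is $0$. A node $v\neq d$ outputs YES iff $w:=\mathrm{par}(v)\ne\bot$ and either $\mathrm{ver}(w)>\mathrm{ver}(v)$, or $\mathrm{ver}(w)=\mathrm{ver}(v)$ and the depth of $v$ equals the depth of $w$ plus $1$. Otherwise it outputs NO. *)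

theory Defs
  imports "Graph_Theory.Graph_Theory"
begin

section \<open>Spanning trees of undirected graphs\<close>

text \<open>
  An undirected simple graph is a \<^locale>\<open>pair_graph\<close>, i.e. a finite symmetric loop-free digraph.
  The library's \<^const>\<open>tree\<close> only excludes directed cycles, so that it rejects every symmetric
  digraph with an edge (\<open>u, v, u\<close> is a directed cycle) and admits directed acyclic graphs
  whose underlying undirected graph has a cycle. For a symmetric loop-free digraph without parallel
  arcs, the undirected cycles are the directed cycles of length at least 3.
\<close>

definition undirected_tree :: "'v pair_pre_digraph \<Rightarrow> bool" where
  "undirected_tree T \<longleftrightarrow> pair_graph T \<and> connected (with_proj T) \<and>
     \<not> (\<exists>p. pre_digraph.cycle (with_proj T) p \<and> 3 \<le> length p)"

definition undirected_spanning_tree :: "'v pair_pre_digraph \<Rightarrow> 'v pair_pre_digraph \<Rightarrow> bool" where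
  "undirected_spanning_tree T G \<longleftrightarrow> undirected_tree T \<and> spanning (with_proj T) (with_proj G)"

text \<open>
  The parent of \<open>v\<close> in the tree \<open>T\<close> rooted at \<open>d\<close> is the vertex after \<open>v\<close> on the (unique) path in
  \<open>T\<close> from \<open>v\<close> to \<open>d\<close>; the depth of \<open>v\<close> is the number of edges of this path.
\<close>

definition tree_parent :: "'v pair_pre_digraph \<Rightarrow> 'v \<Rightarrow> 'v \<Rightarrow> 'v \<Rightarrow> bool" where
  "tree_parent T d v w \<longleftrightarrow> (\<exists>p. pre_digraph.apath (with_proj T) v ((v, w) # p) d)"

definition tree_depth :: "'v pair_pre_digraph \<Rightarrow> 'v \<Rightarrow> 'v \<Rightarrow> nat \<Rightarrow> bool" where
  "tree_depth T d v n \<longleftrightarrow> (\<exists>p. pre_digraph.apath (with_proj T) v p d \<and> length p = n)"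


section \<open>Configurations\<close>

text \<open>The value \<^const>\<open>None\<close> of the parent field means that there is no forwarding rule.\<close>

record 'v label =
  ver :: nat
  par :: "'v option"
  depth :: nat

type_synonym 'v config = "'v \<Rightarrow> 'v label"

text \<open>Only the values of a configuration on the vertices of the graph are meaningful.\<close>

definition configuration :: "'v pair_pre_digraph \<Rightarrow> 'v config \<Rightarrow> bool" where
  "configuration G c \<longleftrightarrow>
     (\<forall>v \<in> pverts G. \<forall>w. par (c v) = Some w \<longrightarrow> (v, w) \<in> parcs G)"

definition blackhole_free :: "'v pair_pre_digraph \<Rightarrow> 'v \<Rightarrow> 'v config \<Rightarrow> bool" where
  "blackhole_free G d c \<longleftrightarrow> (\<forall>v \<in> pverts G. v \<noteq> d \<longrightarrow> par (c v) \<noteq> None)"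

definition forwarding_graph :: "'v pair_pre_digraph \<Rightarrow> 'v config \<Rightarrow> 'v pair_pre_digraph" where
  "forwarding_graph G c =
     \<lparr> pverts = pverts G, parcs = {(v, w). v \<in> pverts G \<and> par (c v) = Some w} \<rparr>"

definition loop_free :: "'v pair_pre_digraph \<Rightarrow> 'v config \<Rightarrow> bool" where
  "loop_free G c \<longleftrightarrow> \<not> (\<exists>p. pre_digraph.cycle (with_proj (forwarding_graph G c)) p)"


section \<open>The update scheme\<close>

text \<open>
  \<open>lab x v\<close> is the label of version \<open>x\<close> for node \<open>v\<close>. For versions \<open>x \<ge> 1\<close> the parents need not
  form a tree and the depths are arbitrary; only for version 0 are they those of a spanning tree
  rooted at \<open>d\<close>. A label of the family need not ever be sent.
\<close>

definition label_family :: "'v pair_pre_digraph \<Rightarrow> 'v \<Rightarrow> (nat \<Rightarrow> 'v \<Rightarrow> 'v label) \<Rightarrow> bool" where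
  "label_family G d lab \<longleftrightarrow>
     (\<forall>x. \<forall>v \<in> pverts G. ver (lab x v) = x) \<and>
     (\<forall>x. par (lab x d) = None \<and> depth (lab x d) = 0) \<and>
     (\<forall>x. \<forall>v \<in> pverts G. v \<noteq> d \<longrightarrow> (\<exists>w. par (lab x v) = Some w \<and> (v, w) \<in> parcs G))"

definition initial_tree_labels :: "'v pair_pre_digraph \<Rightarrow> 'v \<Rightarrow> (nat \<Rightarrow> 'v \<Rightarrow> 'v label) \<Rightarrow> bool" where
  "initial_tree_labels G d lab \<longleftrightarrow>
     (\<exists>T. undirected_spanning_tree T G \<and>
       (\<forall>v \<in> pverts G. tree_depth T d v (depth (lab 0 v))) \<and>
       (\<forall>v \<in> pverts G. v \<noteq> d \<longrightarrow> (\<exists>w. par (lab 0 v) = Some w \<and> tree_parent T d v w)))"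

text \<open>
  \<open>issued\<close> is the largest version issued so far. A pair \<open>(x, v)\<close> in \<open>sent\<close> (\<open>arrived\<close>) records that
  the controller has sent (node \<open>v\<close> has received) the label of version \<open>x\<close> for \<open>v\<close>.
\<close>

record 'v state =
  active :: "'v config"
  issued :: nat
  sent :: "(nat \<times> 'v) set"
  arrived :: "(nat \<times> 'v) set"

definition initial_state :: "(nat \<Rightarrow> 'v \<Rightarrow> 'v label) \<Rightarrow> 'v state" where
  "initial_state lab = \<lparr> active = lab 0, issued = 0, sent = {}, arrived = {} \<rparr>"

inductive step ::
  "'v pair_pre_digraph \<Rightarrow> 'v \<Rightarrow> (nat \<Rightarrow> 'v \<Rightarrow> 'v label) \<Rightarrow> 'v state \<Rightarrow> 'v state \<Rightarrow> bool"
  for G d lab where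
  issue:
    "step G d lab s (s\<lparr> issued := Suc (issued s) \<rparr>)"
| send:
    "v \<in> pverts G \<Longrightarrow> 1 \<le> x \<Longrightarrow> x \<le> issued s \<Longrightarrow> (x, v) \<notin> sent s \<Longrightarrow>
     step G d lab s (s\<lparr> sent := insert (x, v) (sent s) \<rparr>)"
| arrive:
    "(x, v) \<in> sent s \<Longrightarrow>
     step G d lab s (s\<lparr> arrived := insert (x, v) (arrived s) \<rparr>)"
| switch_dest:
    "(x, d) \<in> arrived s \<Longrightarrow> x > ver (active s d) \<Longrightarrow>
     step G d lab s (s\<lparr> active := (active s)(d := lab x d) \<rparr>)"
| switch_node:
    "v \<in> pverts G \<Longrightarrow> v \<noteq> d \<Longrightarrow> (x, v) \<in> arrived s \<Longrightarrow> x > ver (active s v) \<Longrightarrow>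
     par (lab x v) = Some w \<Longrightarrow> ver (active s w) = x \<Longrightarrow>
     depth (lab x v) = depth (lab x w) + 1 \<Longrightarrow>
     step G d lab s (s\<lparr> active := (active s)(v := lab x v) \<rparr>)"

text \<open>Every finite prefix of an execution is a finite sequence of steps.\<close>

definition reachable_state ::
  "'v pair_pre_digraph \<Rightarrow> 'v \<Rightarrow> (nat \<Rightarrow> 'v \<Rightarrow> 'v label) \<Rightarrow> 'v state \<Rightarrow> bool" where
  "reachable_state G d lab s \<longleftrightarrow> (step G d lab)\<^sup>*\<^sup>* (initial_state lab) s"


section \<open>The verifier\<close>

text \<open>
  The verifier at a node is a function of what the node sees: whether it is the destination, its own
  active label, and the active labels of its neighbours (\<^const>\<open>None\<close> for all other vertices).
\<close>

definition verifier :: "bool \<Rightarrow> 'v label \<Rightarrow> ('v \<Rightarrow> 'v label option) \<Rightarrow> bool" where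
  "verifier is_dest own nbr \<longleftrightarrow>
     (if is_dest then par own = None \<and> depth own = 0
      else (\<exists>w l. par own = Some w \<and> nbr w = Some l \<and>
              (ver l > ver own \<or> (ver l = ver own \<and> depth own = depth l + 1))))"

definition neighbour_labels ::
  "'v pair_pre_digraph \<Rightarrow> 'v config \<Rightarrow> 'v \<Rightarrow> 'v \<Rightarrow> 'v label option" where
  "neighbour_labels G c v = (\<lambda>w. if (v, w) \<in> parcs G then Some (c w) else None)"

definition outputs_yes :: "'v pair_pre_digraph \<Rightarrow> 'v \<Rightarrow> 'v config \<Rightarrow> 'v \<Rightarrow> bool" where
  "outputs_yes G d c v \<longleftrightarrow> verifier (v = d) (c v) (neighbour_labels G c v)"

end

theory Submission
  imports Defs
begin

text \<open>
  If every node outputs YES, then along each forwarding edge the version does not decrease, and it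
  strictly increases unless the depth strictly decreases. This is a strict order, so the forwarding
  graph has no cycle: the verifier is sound for arbitrary configurations. For the update scheme it
  then suffices that a switch preserves the YES of every node. The switching node checks its own
  condition, and the other nodes only see a neighbour whose version grows. Initially, the depths
  decrease by one along the parents because paths in a tree are unique.
\<close>

text \<open>Common first arcs are stripped by induction. Where the paths first diverge, to
  \<open>a\<close> and \<open>b\<close>, following one tail to \<open>v\<close> and the other
  backwards joins \<open>a\<close> to \<open>b\<close> without meeting \<open>u\<close>; closing
  this walk through \<open>u\<close> gives a forbidden cycle.\<close>

lemma (in pair_sym_digraph) apath_unique:
  assumes no_cycle: "\<not> (\<exists>p. cycle p \<and> 3 \<le> length p)"
    and "apath u p v" and "apath u q v"
  shows "p = q"
  using assms(2,3)
proof (induction p arbitrary: u q)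
  case Nil
  then show ?case by (cases q) (auto simp: apath_Nil_iff dest: apath_nonempty_ends)
next
  case (Cons e p)
  from Cons.prems have "q \<noteq> []"
    using apath_nonempty_ends[OF Cons.prems(1)] by (auto simp: apath_Nil_iff)
  then obtain f q' where q: "q = f # q'" by (cases q) auto
  obtain a b where e: "e = (u, a)" and f: "f = (u, b)"
    using Cons.prems q by (cases e; cases f) (auto simp: apath_Cons_iff)
  have arcs: "(u, a) \<in> parcs G" "(u, b) \<in> parcs G"
    and p: "apath a p v" "u \<notin> set (awalk_verts a p)"
    and q': "apath b q' v" "u \<notin> set (awalk_verts b q')"
    using Cons.prems q e f by (auto simp: apath_Cons_iff)
  show ?case
  proof (cases "a = b")
    case True
    then show ?thesis using Cons.IH p(1) q'(1) q e f by blast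
  next
    case False
    have awalk_pq: "awalk a (p @ rev_path q') b"
      using awalk_appendI[of a p v "rev_path q'" b] p q' by (simp add: awalkI_apath)
    \<comment> \<open>The two tails may share vertices before \<open>v\<close>, so their
      concatenation need not be a path. Shortcutting it only drops arcs, so \<open>u\<close> stays
      avoided.\<close>
    define r where "r = awalk_to_apath (p @ rev_path q')"
    have r: "apath a r b"
      unfolding r_def using awalk_pq by (rule apath_awalk_to_apath)
    have "set r \<subseteq> set (p @ rev_path q')"
      unfolding r_def using awalk_pq by (rule awalk_to_apath_subset)
    then have "set (awalk_verts a r) \<subseteq> set (awalk_verts a (p @ rev_path q'))"
      using set_awalk_verts[OF awalk_pq] set_awalk_verts[OF awalkI_apath[OF r]] by auto
    also have "\<dots> = set (awalk_verts a p) \<union> set (awalk_verts b q')"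
      using set_awalk_verts_append[of a p v "rev_path q'" b] p q'
        awalk_verts_rev_path[OF awalkI_apath[OF q'(1)]]
      by (simp add: awalkI_apath)
    finally have u: "u \<notin> set (awalk_verts a r)" using p q' by blast
    have "r \<noteq> []" using r False by (auto simp: apath_Nil_iff)
    have "(b, u) \<in> parcs G" using arcs by (auto intro: arcs_symmetric)
    then have "awalk u ((u, a) # r @ [(b, u)]) u"
      using arcs awalkI_apath[OF r] by (auto simp: awalk_simps wellformed')
    moreover have "distinct (tl (awalk_verts u ((u, a) # r @ [(b, u)])))"
      using r u calculation by (auto simp: apath_def awalk_verts_append awalk_Cons_iff)
    ultimately have "cycle ((u, a) # r @ [(b, u)])"
      unfolding cycle_def by blast
    \<comment> \<open>\<open>r\<close> is nonempty because \<open>a\<close> and \<open>b\<close>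
      differ. This excludes the back-and-forth cycles of length 2 that every edge of a symmetric
      digraph produces.\<close>
    moreover have "3 \<le> length ((u, a) # r @ [(b, u)])"
      using \<open>r \<noteq> []\<close> by (cases r) auto
    ultimately show ?thesis using no_cycle by blast
  qed
qed

text \<open>\<open>tree_parent\<close> and \<open>tree_depth\<close> each assert only that some path
  exists; uniqueness makes all these witnesses parts of one path, whose tail after the first arc is
  the path from \<open>w\<close>.\<close>

lemma tree_depth_parent:
  assumes T: "undirected_tree T" and "tree_parent T d v w"
    and "tree_depth T d v m" and "tree_depth T d w n"
  shows "m = n + 1"
proof -
  interpret T: pair_graph T using T by (simp add: undirected_tree_def)
  have no_cycle: "\<not> (\<exists>p. T.cycle p \<and> 3 \<le> length p)"
    using T by (simp add: undirected_tree_def)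
  obtain p where p: "T.apath v ((v, w) # p) d"
    using assms(2) by (auto simp: tree_parent_def)
  then have "T.apath w p d" by (auto simp: T.apath_Cons_iff)
  moreover obtain q r where "T.apath v q d" "length q = m" "T.apath w r d" "length r = n"
    using assms(3,4) by (auto simp: tree_depth_def)
  ultimately have "q = (v, w) # p" and "r = p"
    using p T.apath_unique[OF no_cycle] by blast+
  then show ?thesis using \<open>length q = m\<close> \<open>length r = n\<close> by simp
qed

lemma outputs_yes_dest:
  "outputs_yes G d c d \<longleftrightarrow> par (c d) = None \<and> depth (c d) = 0"
  by (simp add: outputs_yes_def verifier_def)

lemma outputs_yes_node:
  assumes "v \<noteq> d"
  shows "outputs_yes G d c v \<longleftrightarrow>
    (\<exists>w. par (c v) = Some w \<and> (v, w) \<in> parcs G \<and>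
      (ver (c v) < ver (c w) \<or> ver (c v) = ver (c w) \<and> depth (c v) = depth (c w) + 1))"
  using assms by (auto simp: outputs_yes_def verifier_def neighbour_labels_def split: if_splits)

lemma outputs_yes_blackhole_free:
  assumes "\<forall>v \<in> pverts G. outputs_yes G d c v"
  shows "blackhole_free G d c"
  unfolding blackhole_free_def
proof (intro ballI impI)
  fix v assume "v \<in> pverts G" and "v \<noteq> d"
  with assms show "par (c v) \<noteq> None" by (force simp: outputs_yes_node)
qed

text \<open>Each arc ascends strictly in the lexicographic order on (version, reversed depth), and
  transitivity extends this to walks. Free endpoints let the induction go through; a cycle is the
  contradictory case where \<open>u\<close> equals \<open>v\<close>.\<close>

lemma outputs_yes_forwarding_walk:
  assumes yes: "\<forall>v \<in> pverts G. outputs_yes G d c v"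
    and "pre_digraph.cas (with_proj (forwarding_graph G c)) u p v"
    and "set p \<subseteq> parcs (forwarding_graph G c)" and "p \<noteq> []"
  shows "ver (c u) < ver (c v) \<or> ver (c u) = ver (c v) \<and> depth (c v) < depth (c u)"
  using assms(2-)
proof (induction p arbitrary: u)
  case Nil
  then show ?case by simp
next
  case (Cons e p)
  obtain w where e: "e = (u, w)" and u: "u \<in> pverts G" "par (c u) = Some w"
    using Cons.prems by (cases e) (auto simp: pre_digraph.cas.simps forwarding_graph_def)
  \<comment> \<open>A YES at \<open>d\<close> forces its parent to be \<open>None\<close>, so no
    forwarding arc leaves \<open>d\<close>.\<close>
  have "u \<noteq> d" using yes u by (auto simp: outputs_yes_dest)
  then have edge: "ver (c u) < ver (c w) \<or> ver (c u) = ver (c w) \<and> depth (c w) < depth (c u)"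
    using yes u by (auto simp: outputs_yes_node)
  show ?case
  proof (cases "p = []")
    case True
    then show ?thesis using Cons.prems e edge by (simp add: pre_digraph.cas.simps)
  next
    case False
    have "ver (c w) < ver (c v) \<or> ver (c w) = ver (c v) \<and> depth (c v) < depth (c w)"
      using Cons.prems e False by (intro Cons.IH) (auto simp: pre_digraph.cas.simps)
    with edge show ?thesis by auto
  qed
qed

lemma outputs_yes_loop_free:
  assumes "\<forall>v \<in> pverts G. outputs_yes G d c v"
  shows "loop_free G c"
  unfolding loop_free_def
proof
  assume "\<exists>p. pre_digraph.cycle (with_proj (forwarding_graph G c)) p"
  then obtain u p where "pre_digraph.cas (with_proj (forwarding_graph G c)) u p u"
    and "set p \<subseteq> parcs (forwarding_graph G c)" and "p \<noteq> []"
    by (auto simp: pre_digraph.cycle_def pre_digraph.awalk_def)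
  then show False using outputs_yes_forwarding_walk[OF assms] by blast
qed

text \<open>Only a node whose parent is \<open>v\<close> could be disturbed. Its version was at most
  the old version of \<open>v\<close>, hence is strictly below the new one, and the verifier then
  ignores depths.\<close>

lemma outputs_yes_update:
  assumes yes: "\<forall>u \<in> pverts G. outputs_yes G d c u"
    and self: "outputs_yes G d (c(v := l)) v" and ver: "ver (c v) < ver l"
  shows "\<forall>u \<in> pverts G. outputs_yes G d (c(v := l)) u"
proof
  fix u assume u: "u \<in> pverts G"
  then have c: "outputs_yes G d c u" using yes by blast
  show "outputs_yes G d (c(v := l)) u"
  proof (cases "u = v \<or> u = d")
    case True
    then show ?thesis using self c by (cases "u = v") (auto simp: outputs_yes_dest)
  next
    case False
    then obtain w where "par (c u) = Some w" "(u, w) \<in> parcs G"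
      "ver (c u) < ver (c w) \<or> ver (c u) = ver (c w) \<and> depth (c u) = depth (c w) + 1"
      using c outputs_yes_node[of u d G c] by blast
    then show ?thesis
      using False ver outputs_yes_node[of u d G "c(v := l)"] by (cases "w = v") auto
  qed
qed

lemma initial_outputs_yes:
  assumes G: "pair_graph G" and lab: "label_family G d lab" and "initial_tree_labels G d lab"
    and v: "v \<in> pverts G"
  shows "outputs_yes G d (lab 0) v"
proof (cases "v = d")
  case True
  then show ?thesis using lab by (simp add: outputs_yes_dest label_family_def)
next
  case False
  interpret pair_graph G by fact
  obtain T where T: "undirected_tree T"
    and depth: "\<And>v. v \<in> pverts G \<Longrightarrow> tree_depth T d v (depth (lab 0 v))"
    and parent: "\<And>v. v \<in> pverts G \<Longrightarrow> v \<noteq> d \<Longrightarrow>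
      \<exists>w. par (lab 0 v) = Some w \<and> tree_parent T d v w"
    using assms(3) by (auto simp: initial_tree_labels_def undirected_spanning_tree_def)
  \<comment> \<open>The arc of \<open>G\<close> and the tree parent come from two separate
    existential statements; they concern the same \<open>w\<close> because
    \<open>par (lab 0 v)\<close> has one value.\<close>
  obtain w where w: "par (lab 0 v) = Some w" "(v, w) \<in> parcs G" "tree_parent T d v w"
  proof -
    have "\<exists>w. par (lab 0 v) = Some w \<and> (v, w) \<in> parcs G"
      using lab v False unfolding label_family_def by blast
    then show ?thesis using that parent[OF v False] by auto
  qed
  then have "w \<in> pverts G" by (auto dest: in_arcsD2)
  then have "depth (lab 0 v) = depth (lab 0 w) + 1" and "ver (lab 0 v) = ver (lab 0 w)"
    using tree_depth_parent[OF T w(3)] depth v lab by (auto simp: label_family_def)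
  then show ?thesis using w False by (auto simp: outputs_yes_node)
qed

text \<open>The first conjunct strengthens the invariant: the switching rule tests the depth in
  \<open>lab x w\<close>, whereas the verifier reads the active depth of \<open>w\<close>. Knowing
  that active labels come from \<open>lab\<close> identifies the two.\<close>

lemma reachable_outputs_yes:
  assumes G: "pair_graph G" and d: "d \<in> pverts G"
    and lab: "label_family G d lab" and init: "initial_tree_labels G d lab"
    and reach: "reachable_state G d lab s"
  shows "(\<forall>v \<in> pverts G. active s v = lab (ver (active s v)) v) \<and>
    (\<forall>v \<in> pverts G. outputs_yes G d (active s) v)"
  using reach unfolding reachable_state_def
proof (induction rule: rtranclp_induct)
  case base
  show ?case
    using initial_outputs_yes[OF G lab init] lab
    by (auto simp: initial_state_def label_family_def)
next
  case (step s t)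
  interpret pair_graph G by fact
  have ver: "\<And>x v. v \<in> pverts G \<Longrightarrow> ver (lab x v) = x"
    using lab by (simp add: label_family_def)
  from step.hyps(2) step.IH show ?case
  proof (induction rule: step.induct)
    case (switch_dest x s)
    have "outputs_yes G d ((active s)(d := lab x d)) d"
      using lab by (simp add: outputs_yes_dest label_family_def)
    then have "\<forall>v \<in> pverts G. outputs_yes G d ((active s)(d := lab x d)) v"
      using switch_dest ver[OF d] by (intro outputs_yes_update) auto
    moreover have "\<forall>v \<in> pverts G. ((active s)(d := lab x d)) v =
        lab (ver (((active s)(d := lab x d)) v)) v"
      using switch_dest ver by simp
    ultimately show ?case by (simp del: fun_upd_apply)
  next
    case (switch_node v x s w)
    have arc: "(v, w) \<in> parcs G"
    proof -
      have "\<exists>w. par (lab x v) = Some w \<and> (v, w) \<in> parcs G"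
        using lab switch_node.hyps(1,2) unfolding label_family_def by blast
      then show ?thesis using switch_node.hyps(5) by auto
    qed
    then have "w \<in> pverts G" by (rule in_arcsD2)
    then have "active s w = lab x w"
      using switch_node.prems switch_node.hyps(6) by blast
    \<comment> \<open>The active version of \<open>w\<close> is \<open>x\<close>, that of
      \<open>v\<close> is smaller; so the update at \<open>v\<close> leaves the label of
      \<open>w\<close> intact.\<close>
    moreover have "w \<noteq> v" using switch_node.hyps by auto
    ultimately have "outputs_yes G d ((active s)(v := lab x v)) v"
      using switch_node.hyps arc ver[OF switch_node.hyps(1)] ver[OF \<open>w \<in> pverts G\<close>]
      by (simp add: outputs_yes_node)
    then have "\<forall>u \<in> pverts G. outputs_yes G d ((active s)(v := lab x v)) u"
      using switch_node ver by (intro outputs_yes_update) auto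
    moreover have "\<forall>u \<in> pverts G. ((active s)(v := lab x v)) u =
        lab (ver (((active s)(v := lab x v)) u)) u"
      using switch_node ver by simp
    ultimately show ?case by (simp del: fun_upd_apply)
  \<comment> \<open>Issuing, sending and arrival leave \<open>active\<close> unchanged.\<close>
  qed simp_all
qed

theorem theorem2:
  fixes G :: "'v pair_pre_digraph" and d :: 'v
  assumes "pair_graph G" and "connected (with_proj G)" and "d \<in> pverts G"
  shows "(\<forall>lab s. label_family G d lab \<longrightarrow> initial_tree_labels G d lab \<longrightarrow>
             reachable_state G d lab s \<longrightarrow>
             blackhole_free G d (active s) \<and> loop_free G (active s) \<and>
             (\<forall>v \<in> pverts G. outputs_yes G d (active s) v))
       \<and> (\<forall>c. configuration G c \<longrightarrow> \<not> (blackhole_free G d c \<and> loop_free G c) \<longrightarrow>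
             (\<exists>v \<in> pverts G. \<not> outputs_yes G d c v))"
proof (intro conjI allI impI)
  fix lab s
  assume "label_family G d lab" and "initial_tree_labels G d lab" and "reachable_state G d lab s"
  then have yes: "\<forall>v \<in> pverts G. outputs_yes G d (active s) v"
    using reachable_outputs_yes[OF assms(1,3)] by simp
  then show "\<forall>v \<in> pverts G. outputs_yes G d (active s) v" .
  show "blackhole_free G d (active s)" using yes by (rule outputs_yes_blackhole_free)
  show "loop_free G (active s)" using yes by (rule outputs_yes_loop_free)
next
  fix c assume "\<not> (blackhole_free G d c \<and> loop_free G c)"
  then show "\<exists>v \<in> pverts G. \<not> outputs_yes G d c v"
    using outputs_yes_blackhole_free[of G d c] outputs_yes_loop_free[of G d c] by blast
qed

end
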